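(* Let $H$ be a graph that is one of the following: (1) a path $P_k$; (2) a cycle $C_k$; (3) a star $S_k$; (4) a spider graph in $SP_k$ with $k\le 4$. Then for any graph $G$, $\mu_{\mathrm{int}}(G\odot H)\le \max\{2,\mu_{\mathrm{int}}(G)\}$.
   Context: Graphs are finite and simple. $P_k$ is the path with $k$ vertices; $C_k$ ($k\ge 3$) is the cycle with $k$ vertices; the star $S_k=K_{1,k}$ has a center vertex adjacent to $k$ leaves. A spider graph is a tree with a center vertex of degree at least $3$ and all other vertices of degree at most $2$; $SP_k$ denotes the family of spider graphs whose center has degree exactly $k$. For graphs $G$ and $H$ with $V(G)=\{v_1,\dots,v_n\}$, the corona product $G\odot H$ is the graph obtained by taking $G$ and $n$ disjoint copies $H_1,\dots,H_n$ of $H$ and, for each $i\in\{1,\dots,n\}$, adding the edge $v_ix$ for every $x\in V(H_i)$. An improper interval coloring of a graph $G$ is an assignment of colors (natural numbers) to the edges of $G$, not necessarily proper, such that for every vertex $v$ the set of colors on the edges incident with $v$ is an integral interval (a set of consecutive integers). It is $k$-improper if at most $k$ edges with the same color all share a common endpoint, i.e. at each vertex each color appears on at most $k$ incident edges. The interval coloring impropriety $\mu_{\mathrm{int}}(G)$ is the smallest positive integer $k$ such that $G$ has a $k$-improper interval coloring. *)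

theory Defs
  imports Main
begin

record 'a sgraph =
  verts :: "'a set"
  edges :: "'a set set"

definition simple_graph :: "'a sgraph \<Rightarrow> bool" where
  "simple_graph G \<longleftrightarrow> finite (verts G) \<and> (\<forall>e\<in>edges G. e \<subseteq> verts G \<and> card e = 2)"

definition incident_edges :: "'a sgraph \<Rightarrow> 'a \<Rightarrow> 'a set set" where
  "incident_edges G v = {e \<in> edges G. v \<in> e}"

definition degree :: "'a sgraph \<Rightarrow> 'a \<Rightarrow> nat" where
  "degree G v = card (incident_edges G v)"

definition isomorphic :: "'a sgraph \<Rightarrow> 'b sgraph \<Rightarrow> bool" (infix "\<cong>\<^sub>g" 50) where
  "G \<cong>\<^sub>g H \<longleftrightarrow> (\<exists>f. bij_betw f (verts G) (verts H) \<and> edges H = (\<lambda>e. f ` e) ` edges G)"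

definition path_graph :: "nat \<Rightarrow> nat sgraph" where
  "path_graph k = \<lparr>verts = {0..<k}, edges = {{i, i + 1} | i. i + 1 < k}\<rparr>"

definition cycle_graph :: "nat \<Rightarrow> nat sgraph" where
  "cycle_graph k = \<lparr>verts = {0..<k}, edges = {{i, (i + 1) mod k} | i. i < k}\<rparr>"

text \<open>The star \<open>K\<^sub>1\<^sub>,\<^sub>k\<close>, with center \<open>0\<close> and leaves \<open>1, \<dots>, k\<close>.\<close>
definition star_graph :: "nat \<Rightarrow> nat sgraph" where
  "star_graph k = \<lparr>verts = {0..k}, edges = {{0, i} | i. 1 \<le> i \<and> i \<le> k}\<rparr>"

definition connected_graph :: "'a sgraph \<Rightarrow> bool" where
  "connected_graph G \<longleftrightarrow> verts G \<noteq> {} \<and>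
     (\<forall>u\<in>verts G. \<forall>v\<in>verts G. (u, v) \<in> {(x, y). {x, y} \<in> edges G}\<^sup>*)"

definition subgraph_embedding :: "('a \<Rightarrow> 'b) \<Rightarrow> 'a sgraph \<Rightarrow> 'b sgraph \<Rightarrow> bool" where
  "subgraph_embedding f G H \<longleftrightarrow>
     inj_on f (verts G) \<and> f ` verts G \<subseteq> verts H \<and> (\<lambda>e. f ` e) ` edges G \<subseteq> edges H"

definition acyclic_graph :: "'a sgraph \<Rightarrow> bool" where
  "acyclic_graph G \<longleftrightarrow> \<not> (\<exists>k\<ge>3. \<exists>f. subgraph_embedding f (cycle_graph k) G)"

definition tree :: "'a sgraph \<Rightarrow> bool" where
  "tree G \<longleftrightarrow> simple_graph G \<and> connected_graph G \<and> acyclic_graph G"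

text \<open>Spider graphs whose center has degree exactly \<open>k\<close>; empty for \<open>k < 3\<close>.\<close>
definition SP :: "nat \<Rightarrow> 'a sgraph set" where
  "SP k = {H. tree H \<and>
     (\<exists>c\<in>verts H. degree H c \<ge> 3 \<and> degree H c = k \<and> (\<forall>v\<in>verts H - {c}. degree H v \<le> 2))}"

text \<open>A vertex \<open>v\<close> of \<open>G\<close> becomes \<open>Inl v\<close>; the vertex \<open>x\<close> in the copy of \<open>H\<close> attached to \<open>v\<close>
  becomes \<open>Inr (v, x)\<close>.\<close>
definition corona :: "'a sgraph \<Rightarrow> 'b sgraph \<Rightarrow> ('a + 'a \<times> 'b) sgraph" (infixl "\<odot>" 70) where
  "G \<odot> H = \<lparr>verts = Inl ` verts G \<union> Inr ` (verts G \<times> verts H),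
     edges = (\<lambda>e. Inl ` e) ` edges G
       \<union> {(\<lambda>x. Inr (v, x)) ` e | v e. v \<in> verts G \<and> e \<in> edges H}
       \<union> {{Inl v, Inr (v, x)} | v x. v \<in> verts G \<and> x \<in> verts H}\<rparr>"

text \<open>The interval \<open>{a..b}\<close> may be empty, which is needed for isolated vertices.\<close>
definition improper_interval_coloring :: "'a sgraph \<Rightarrow> ('a set \<Rightarrow> nat) \<Rightarrow> bool" where
  "improper_interval_coloring G c \<longleftrightarrow> (\<forall>v\<in>verts G. \<exists>a b. c ` incident_edges G v = {a..b})"

definition k_improper :: "nat \<Rightarrow> 'a sgraph \<Rightarrow> ('a set \<Rightarrow> nat) \<Rightarrow> bool" where
  "k_improper k G c \<longleftrightarrow>
     (\<forall>v\<in>verts G. \<forall>j. card {e \<in> incident_edges G v. c e = j} \<le> k)"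

definition mu_int :: "'a sgraph \<Rightarrow> nat" where
  "mu_int G = (LEAST k. k \<ge> 1 \<and> (\<exists>c. improper_interval_coloring G c \<and> k_improper k G c))"

lemma finite_edges:
  assumes "simple_graph G"
  shows "finite (edges G)"
proof (rule finite_subset)
  show "edges G \<subseteq> Pow (verts G)" using assms by (auto simp: simple_graph_def)
  show "finite (Pow (verts G))" using assms by (auto simp: simple_graph_def)
qed

lemma simple_graph_corona:
  assumes "simple_graph G" "simple_graph H"
  shows "simple_graph (G \<odot> H)"
proof -
  have "card (Inl ` e :: ('a + 'a \<times> 'b) set) = 2" if "e \<in> edges G" for e
    using assms(1) that by (simp add: card_image simple_graph_def)
  moreover have "card ((\<lambda>x. Inr (v, x)) ` e :: ('a + 'a \<times> 'b) set) = 2" if "e \<in> edges H" for v e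
    using assms(2) that by (subst card_image) (auto simp: inj_on_def simple_graph_def)
  ultimately show ?thesis
    using assms unfolding simple_graph_def corona_def by fastforce
qed

text \<open>The set whose least element is \<open>mu_int G\<close> is never empty: give every edge the same color.\<close>
lemma mu_int_exists:
  assumes "simple_graph G"
  shows "\<exists>k\<ge>1. \<exists>c. improper_interval_coloring G c \<and> k_improper k G c"
proof (intro exI conjI)
  show "improper_interval_coloring G (\<lambda>_. 0)"
    unfolding improper_interval_coloring_def
  proof
    fix v
    have "(\<lambda>_. 0::nat) ` incident_edges G v = {1..0} \<or> (\<lambda>_. 0::nat) ` incident_edges G v = {0..0}"
      by auto
    then show "\<exists>a b. (\<lambda>_. 0::nat) ` incident_edges G v = {a..b}" by blast
  qed
  show "k_improper (Suc (card (edges G))) G (\<lambda>_. 0)"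
    unfolding k_improper_def
    by (auto simp: incident_edges_def intro!: le_SucI card_mono finite_edges assms)
qed simp

end

theory Submission
  imports Defs "HOL-Library.Multiset"
begin

text \<open>
  The bound comes from a property of \<open>H\<close> alone. Suppose that the cone over \<open>H\<close>, that is, \<open>H\<close>
  together with one apex joined to all of its vertices, has a \<open>k\<close>-improper interval coloring.
  In \<open>G \<odot> H\<close> every vertex \<open>v\<close> of \<open>G\<close> is the apex of its own cone. Interval colorings survive
  translation, so the coloring of the cone at \<open>v\<close> can be moved up until the colors of its apex
  edges start right above the largest color that an optimal coloring of \<open>G\<close> uses at \<open>v\<close>. The colors
  at \<open>v\<close> then form two adjacent intervals, no color occurs in both, and no vertex of a
  copy of \<open>H\<close> notices anything but a translation. Hence \<open>G \<odot> H\<close> has impropriety at most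
  \<open>max k (mu_int G)\<close> (lemma \<open>mu_int_corona_le\<close>).

  What remains is to find a \<open>2\<close>-improper interval coloring of the cone over each \<open>H\<close>. The apex
  can carry each color twice, so the colors of the apex edges have to advance, on average, by at
  least one per two vertices of \<open>H\<close>, whereas a vertex of degree \<open>2\<close> in \<open>H\<close> only tolerates
  steps of bounded size.
  \<^item> In a path the colors advance by one per vertex. In a star, the center and the apex are joined
    to the same leaves and can use the same colors, each for at most two leaves.
  \<^item> In a cycle the colors go up along one half and down along the other one, so that each color is
    used at most once on either side; only the turning points need care.
  \<^item> In a spider the colors go up along all legs, starting from the center. The colors of the apex
    edges of a leg can advance by as much as two per vertex, so that a leg occupies every second color
    and two legs fit on the odd colors and two on the even ones. This is where four legs come
    from. The two longest legs get different parities, so that there is no gap when the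
    shorter legs end; when the second longest leg ends as well, the longest one slows down to one color
    per vertex.

  For spiders, which are given by degrees, connectedness and the absence of cycles, the
  legs must be found first: they are the maximal paths that leave the center through its neighbors
  (lemma \<open>spider_isomorphic\<close>).
\<close>

section \<open>Interval colorings as multisets of colors\<close>

text \<open>
  Both requirements on a coloring at a vertex concern only the multiset of the colors that meet there.
  Multisets turn the merging of colorings at a common vertex into addition.
\<close>
definition interval_mset :: "nat \<Rightarrow> nat multiset \<Rightarrow> bool" where
  "interval_mset k M \<longleftrightarrow> (\<exists>a b. set_mset M = {a..b}) \<and> (\<forall>j. count M j \<le> k)"

definition color_mset :: "'a sgraph \<Rightarrow> ('a set \<Rightarrow> nat) \<Rightarrow> 'a \<Rightarrow> nat multiset" where
  "color_mset G c v = image_mset c (mset_set (incident_edges G v))"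

text \<open>
  A coloring of the cone over \<open>H\<close> consists of \<open>f\<close>, which gives the colors of the edges from the apex to
  the vertices of \<open>H\<close>, and \<open>g\<close>, which gives the colors of the edges of \<open>H\<close>. The first condition is the
  one at the apex.
\<close>
definition cone_colorable :: "nat \<Rightarrow> 'a sgraph \<Rightarrow> bool" where
  "cone_colorable k H \<longleftrightarrow> (\<exists>f g. interval_mset k (image_mset f (mset_set (verts H))) \<and>
     (\<forall>x\<in>verts H. interval_mset k (add_mset (f x) (color_mset H g x))))"

lemma finite_incident_edges: "simple_graph G \<Longrightarrow> finite (incident_edges G v)"
  by (simp add: incident_edges_def finite_edges)

lemma count_image_mset_mset_set:
  "finite A \<Longrightarrow> count (image_mset f (mset_set A)) j = card {x \<in> A. f x = j}"
  unfolding count_image_mset card_eq_sum by (intro sum.cong) auto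

lemma coloring_iff_interval_mset:
  assumes "simple_graph G"
  shows "improper_interval_coloring G c \<and> k_improper k G c \<longleftrightarrow>
    (\<forall>v\<in>verts G. interval_mset k (color_mset G c v))"
proof -
  have "count (color_mset G c v) j = card {e \<in> incident_edges G v. c e = j}" for v j
    by (simp add: color_mset_def count_image_mset_mset_set finite_incident_edges assms)
  moreover have "set_mset (color_mset G c v) = c ` incident_edges G v" for v
    by (simp add: color_mset_def finite_incident_edges assms)
  ultimately show ?thesis
    by (auto simp: improper_interval_coloring_def k_improper_def interval_mset_def)
qed

lemma count_image_mset_shift: "count (image_mset (\<lambda>n. n + s) M) (i + s) = count M (i::nat)"
  by (induction M) auto

lemma interval_mset_mono: "interval_mset k M \<Longrightarrow> k \<le> l \<Longrightarrow> interval_mset l M"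
  by (auto simp: interval_mset_def intro: le_trans)

lemma interval_mset_shift:
  assumes "interval_mset k M"
  shows "interval_mset k (image_mset (\<lambda>n. n + s) M)"
proof -
  obtain a b where "set_mset M = {a..b}" using assms by (auto simp: interval_mset_def)
  then have "set_mset (image_mset (\<lambda>n. n + s) M) = {a + s..b + s}"
    by simp
  moreover have "count (image_mset (\<lambda>n. n + s) M) j \<le> k" for j
  proof (cases "j \<in># image_mset (\<lambda>n. n + s) M")
    case True
    then obtain i where "j = i + s" by auto
    then show ?thesis
      using assms by (simp add: interval_mset_def count_image_mset_shift)
  next
    case False
    then show ?thesis by (simp only: not_in_iff)
  qed
  ultimately show ?thesis unfolding interval_mset_def by blast
qed

lemma interval_mset_append:
  assumes "interval_mset k M" "interval_mset k N"
    and "set_mset M = {a..b}" "a \<le> b" "set_mset N = {Suc b..d}"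
  shows "interval_mset k (M + N)"
proof -
  have "set_mset (M + N) = {a..max b d}" using assms by auto
  moreover have "count (M + N) j \<le> k" for j
  proof (cases "j \<le> b")
    case True
    then have "j \<notin># N" using assms(5) by simp
    then have "count N j = 0" by (simp add: not_in_iff)
    then show ?thesis using assms(1) by (simp add: interval_mset_def)
  next
    case False
    then have "j \<notin># M" using assms(3) by simp
    then have "count M j = 0" by (simp add: not_in_iff)
    then show ?thesis using assms(2) by (simp add: interval_mset_def)
  qed
  ultimately show ?thesis unfolding interval_mset_def by blast
qed

text \<open>
  The amount \<open>t\<close> by which \<open>N\<close> moves depends only on \<open>M\<close>, and the amount \<open>a\<close> by which \<open>M\<close> moves only on
  \<open>N\<close>. In the corona, \<open>N\<close> is the same at all vertices of \<open>G\<close>, so that the whole coloring of \<open>G\<close> is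
  translated by one constant, while each copy of \<open>H\<close> is free to move by its own amount. Moving \<open>M\<close>
  by \<open>a\<close> replaces the subtraction of \<open>a\<close> from \<open>N\<close>, which could lead to negative colors elsewhere.
\<close>
lemma interval_mset_stack:
  assumes "interval_mset k M" "interval_mset k N" "set_mset N = {a..b}"
  defines "t \<equiv> if M = {#} then 0 else Suc (Max_mset M)"
  shows "interval_mset k (image_mset (\<lambda>n. n + a) M + image_mset (\<lambda>n. n + t) N)"
proof (cases "M = {#}")
  case False
  then obtain p q where M: "set_mset M = {p..q}" "p \<le> q"
    using assms(1) unfolding interval_mset_def by fastforce
  moreover have "set_mset (image_mset (\<lambda>n. n + t) N) = {a + t..b + t}"
    using assms(3) by simp
  moreover have "t = Suc q" using M False by (auto simp: t_def intro: Max_eqI)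
  ultimately show ?thesis
    using assms(1,2)
    by (intro interval_mset_append[where a = "p + a" and b = "q + a" and d = "b + t"]
        interval_mset_shift) (auto simp: add.commute)
qed (simp add: interval_mset_shift assms)

section \<open>Coloring a corona\<close>

lemma interval_colorings_corona:
  fixes G :: "'a sgraph" and H :: "'b sgraph"
  assumes G: "simple_graph G" and H: "simple_graph H"
    and c: "\<And>v. v \<in> verts G \<Longrightarrow> interval_mset k (color_mset G c v)"
    and "cone_colorable k H"
  obtains c' where "\<And>w. w \<in> verts (G \<odot> H) \<Longrightarrow> interval_mset k (color_mset (G \<odot> H) c' w)"
proof -
  obtain f g where f: "interval_mset k (image_mset f (mset_set (verts H)))"
    and g: "\<And>x. x \<in> verts H \<Longrightarrow> interval_mset k (add_mset (f x) (color_mset H g x))"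
    using assms(4) by (auto simp: cone_colorable_def)
  obtain a b where ab: "set_mset (image_mset f (mset_set (verts H))) = {a..b}"
    using f by (auto simp: interval_mset_def)
  define t where "t v = (if color_mset G c v = {#} then 0 else Suc (Max_mset (color_mset G c v)))" for v
  \<comment> \<open>An edge of the corona determines the vertex of \<open>G\<close> whose copy of \<open>H\<close> it meets and the vertices
    of \<open>H\<close> that it contains; both are recovered here from the edge as a set.\<close>
  define owner where "owner E = (SOME v. \<exists>x. Inr (v, x) \<in> E)" for E :: "('a + 'a \<times> 'b) set"
  define trace where "trace E = {x. \<exists>v. Inr (v, x) \<in> E}" for E :: "('a + 'a \<times> 'b) set"
  define c' where "c' E = (if E \<subseteq> range Inl then c (Inl -` E) + a
    else if E \<subseteq> range Inr then g (trace E) + t (owner E)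
    else f (the_elem (trace E)) + t (owner E))" for E :: "('a + 'a \<times> 'b) set"
  let ?base = "\<lambda>e::'a set. Inl ` e :: ('a + 'a \<times> 'b) set"
  let ?copy = "\<lambda>v (e::'b set). (\<lambda>x. Inr (v, x)) ` e :: ('a + 'a \<times> 'b) set"
  let ?spoke = "\<lambda>v x. {Inl v, Inr (v, x)} :: ('a + 'a \<times> 'b) set"
  have c'_base: "c' (?base e) = c e + a" for e
    by (simp add: c'_def inj_vimage_image_eq image_mono)
  have c'_copy: "c' (?copy v e) = g e + t v" if "e \<in> edges H" for v e
  proof -
    have "e \<noteq> {}" using that H by (auto simp: simple_graph_def)
    then have "owner (?copy v e) = v" "trace (?copy v e) = e" "\<not> ?copy v e \<subseteq> range Inl"
      by (auto simp: owner_def trace_def)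
    then show ?thesis by (auto simp: c'_def)
  qed
  have c'_spoke: "c' (?spoke v x) = f x + t v" for v x
    by (auto simp: c'_def owner_def trace_def)
  have fin: "finite (verts H)" "finite (incident_edges G v)" "finite (incident_edges H x)" for v x
    using G H by (auto simp: finite_incident_edges simple_graph_def)
  show thesis
  proof
    fix w assume "w \<in> verts (G \<odot> H)"
    then consider v where "v \<in> verts G" "w = Inl v"
      | v x where "v \<in> verts G" "x \<in> verts H" "w = Inr (v, x)"
      by (auto simp: corona_def)
    then show "interval_mset k (color_mset (G \<odot> H) c' w)"
    proof cases
      case 1
      have "incident_edges (G \<odot> H) w = ?base ` incident_edges G v \<union> ?spoke v ` verts H"
        using 1 by (auto simp: incident_edges_def corona_def)
      moreover have "?base ` incident_edges G v \<inter> ?spoke v ` verts H = {}" by auto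
      moreover have "inj_on ?base (incident_edges G v)" "inj_on (?spoke v) (verts H)"
        by (auto simp: inj_on_def doubleton_eq_iff)
      ultimately have "color_mset (G \<odot> H) c' w =
          image_mset c' (image_mset ?base (mset_set (incident_edges G v)))
          + image_mset c' (image_mset (?spoke v) (mset_set (verts H)))"
        using fin by (simp add: color_mset_def mset_set_Union image_mset_mset_set)
      also have "\<dots> = image_mset (\<lambda>n. n + a) (color_mset G c v)
          + image_mset (\<lambda>n. n + t v) (image_mset f (mset_set (verts H)))"
        by (simp add: color_mset_def multiset.map_comp comp_def c'_base c'_spoke)
      finally show ?thesis
        using interval_mset_stack[OF c[OF 1(1)] f ab] by (simp add: t_def)
    next
      case 2
      have "incident_edges (G \<odot> H) w = insert (?spoke v x) (?copy v ` incident_edges H x)"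
        using 2 H by (auto simp: incident_edges_def corona_def)
      moreover have "?spoke v x \<notin> ?copy v ` incident_edges H x" by auto
      moreover have "inj_on (?copy v) (incident_edges H x)"
        by (auto simp: inj_on_def inj_image_eq_iff)
      ultimately have "color_mset (G \<odot> H) c' w = add_mset (c' (?spoke v x))
          (image_mset c' (image_mset (?copy v) (mset_set (incident_edges H x))))"
        using fin by (simp add: color_mset_def image_mset_mset_set)
      also have "image_mset c' (image_mset (?copy v) (mset_set (incident_edges H x)))
          = image_mset (\<lambda>n. n + t v) (color_mset H g x)"
        unfolding color_mset_def multiset.map_comp comp_def
        using fin by (intro image_mset_cong) (auto simp: incident_edges_def c'_copy)
      finally show ?thesis
        using interval_mset_shift[OF g[OF 2(2)], of "t v"] by (simp add: c'_spoke)
    qed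
  qed
qed

text \<open>
  Since the colors of the two intervals at a vertex of \<open>G\<close> do not overlap, the multiplicities there
  do not add up: the larger of the two bounds survives.
\<close>
theorem mu_int_corona_le:
  assumes G: "simple_graph G" and H: "simple_graph H" and k: "1 \<le> k" "cone_colorable k H"
  shows "mu_int (G \<odot> H) \<le> max k (mu_int G)"
proof -
  let ?m = "max k (mu_int G)"
  obtain c where "improper_interval_coloring G c \<and> k_improper (mu_int G) G c"
    using LeastI_ex[OF mu_int_exists[OF G]] unfolding mu_int_def by blast
  then have "interval_mset ?m (color_mset G c v)" if "v \<in> verts G" for v
    using that by (auto simp: coloring_iff_interval_mset[OF G] intro: interval_mset_mono)
  moreover have "cone_colorable ?m H"
    using k(2) unfolding cone_colorable_def by (meson interval_mset_mono max.cobounded1)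
  ultimately obtain c' where "\<forall>w\<in>verts (G \<odot> H). interval_mset ?m (color_mset (G \<odot> H) c' w)"
    using interval_colorings_corona[OF G H] by metis
  then show ?thesis
    using k(1) coloring_iff_interval_mset[OF simple_graph_corona[OF G H]]
    unfolding mu_int_def by (intro Least_le) auto
qed

section \<open>Constructing cone colorings\<close>

text \<open>
  Formulas for edge colors refer to an index of the edge, such as the end farther from
  a root, rather than to the edge as a set. An injective indexing lets the condition at a vertex be
  read off from the indices of the edges that contain it.
\<close>
lemma color_mset_indexed:
  assumes "edges H = E ` I" "inj_on E I" "finite I"
  shows "color_mset H (h \<circ> inv_into I E) x = image_mset h (mset_set {i \<in> I. x \<in> E i})"
proof -
  let ?J = "{i \<in> I. x \<in> E i}"
  have "incident_edges H x = E ` ?J"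
    using assms(1) by (auto simp: incident_edges_def)
  moreover have "inj_on E ?J" using assms(2) by (auto intro: inj_on_subset)
  ultimately have "color_mset H (h \<circ> inv_into I E) x
      = image_mset (\<lambda>i. h (inv_into I E (E i))) (mset_set ?J)"
    by (simp add: color_mset_def multiset.map_comp comp_def flip: image_mset_mset_set)
  also have "\<dots> = image_mset h (mset_set ?J)"
    using assms by (intro image_mset_cong) auto
  finally show ?thesis .
qed

lemma cone_colorable_indexed:
  assumes "edges H = E ` I" "inj_on E I" "finite I"
    and "interval_mset k (image_mset f (mset_set (verts H)))"
    and "\<And>x. x \<in> verts H \<Longrightarrow>
      interval_mset k (add_mset (f x) (image_mset h (mset_set {i \<in> I. x \<in> E i})))"
  shows "cone_colorable k H"
  unfolding cone_colorable_def using assms(4,5) color_mset_indexed[OF assms(1-3)] by metis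

lemma isomorphic_sym:
  assumes "edges G \<subseteq> Pow (verts G)" "G \<cong>\<^sub>g H"
  shows "H \<cong>\<^sub>g G"
proof -
  obtain \<phi> where \<phi>: "bij_betw \<phi> (verts G) (verts H)" "edges H = (`) \<phi> ` edges G"
    using assms(2) by (auto simp: isomorphic_def)
  have "inv_into (verts G) \<phi> ` \<phi> ` e = e" if "e \<in> edges G" for e
    using that assms(1) \<phi>(1) by (intro inv_into_image_cancel) (auto simp: bij_betw_def)
  then have "edges G = (`) (inv_into (verts G) \<phi>) ` edges H"
    using \<phi>(2) by (simp add: image_image)
  then show ?thesis
    using bij_betw_inv_into[OF \<phi>(1)] by (auto simp: isomorphic_def)
qed

lemma cone_colorable_isomorphic:
  assumes "edges H \<subseteq> Pow (verts H)" "H \<cong>\<^sub>g H'" "cone_colorable k H'"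
  shows "cone_colorable k H"
proof -
  obtain \<phi> where \<phi>: "bij_betw \<phi> (verts H) (verts H')" "edges H' = (`) \<phi> ` edges H"
    using assms(2) by (auto simp: isomorphic_def)
  then have inj: "inj_on \<phi> (verts H)" and im: "\<phi> ` verts H = verts H'"
    by (auto simp: bij_betw_def)
  obtain f g where f: "interval_mset k (image_mset f (mset_set (verts H')))"
    and g: "\<And>x. x \<in> verts H' \<Longrightarrow> interval_mset k (add_mset (f x) (color_mset H' g x))"
    using assms(3) by (auto simp: cone_colorable_def)
  have "color_mset H (g \<circ> (`) \<phi>) x = color_mset H' g (\<phi> x)" if "x \<in> verts H" for x
  proof -
    have "\<phi> x \<in> \<phi> ` e \<longleftrightarrow> x \<in> e" if "e \<in> edges H" for e
      using \<open>x \<in> verts H\<close> that assms(1) by (intro inj_on_image_mem_iff[OF inj]) auto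
    then have "incident_edges H' (\<phi> x) = (`) \<phi> ` incident_edges H x"
      by (auto simp: incident_edges_def \<phi>(2))
    moreover have "inj_on ((`) \<phi>) (incident_edges H x)"
      using assms(1) by (intro inj_on_subset[OF inj_on_image_Pow[OF inj]]) (auto simp: incident_edges_def)
    ultimately show ?thesis
      by (simp add: color_mset_def multiset.map_comp flip: image_mset_mset_set)
  qed
  moreover have "image_mset (f \<circ> \<phi>) (mset_set (verts H)) = image_mset f (mset_set (verts H'))"
    by (simp add: multiset.map_comp im[symmetric] flip: image_mset_mset_set[OF inj])
  ultimately show ?thesis
    using f g im unfolding cone_colorable_def
    by (intro exI[of _ "f \<circ> \<phi>"] exI[of _ "g \<circ> (`) \<phi>"]) auto
qed

lemma interval_mset_2_image:
  assumes "finite A" "f ` A = {0..b}" "\<And>j. \<exists>x y. {z \<in> A. f z = j} \<subseteq> {x, y}"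
  shows "interval_mset 2 (image_mset f (mset_set A))"
proof -
  have "card {z \<in> A. f z = j} \<le> 2" for j
  proof -
    obtain x y where "{z \<in> A. f z = j} \<subseteq> {x, y}" using assms(3) by blast
    then have "card {z \<in> A. f z = j} \<le> card {x, y}" by (simp add: card_mono)
    also have "\<dots> \<le> 2" by (simp add: card_insert_if)
    finally show ?thesis .
  qed
  then show ?thesis
    using assms(1,2) by (auto simp: interval_mset_def count_image_mset_mset_set)
qed

lemma interval_mset_pair:
  assumes "a \<le> b" "b \<le> Suc a"
  shows "interval_mset 2 {#a, b#}"
proof -
  have "set_mset {#a, b#} = {a..b}" using assms by auto
  then show ?thesis unfolding interval_mset_def by auto
qed

lemma interval_mset_triple:
  assumes "a \<le> b" "b \<le> Suc a" "b \<le> c" "c \<le> Suc b" "a < c"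
  shows "interval_mset 2 {#a, b, c#}"
proof -
  have "set_mset {#a, b, c#} = {a..c}" using assms by auto
  then show ?thesis using assms unfolding interval_mset_def by auto
qed

section \<open>Paths, stars and cycles\<close>

text \<open>An inner vertex \<open>i\<close> sees the colors \<open>i - 1, i, i\<close>, the first of them on the edge back to \<open>i - 1\<close>.\<close>
lemma cone_colorable_path:
  assumes "1 \<le> k"
  shows "cone_colorable 2 (path_graph k)"
proof (rule cone_colorable_indexed[where I = "{1..<k}" and E = "\<lambda>i. {i - 1, i}"
      and f = id and h = "\<lambda>i. i - 1"])
  show "edges (path_graph k) = (\<lambda>i. {i - 1, i}) ` {1..<k}"
  proof -
    have "{i, i + 1} \<in> (\<lambda>i. {i - 1, i}) ` {1..<k}" if "i + 1 < k" for i
      using that by (intro image_eqI[of _ _ "i + 1"]) auto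
    moreover have "\<exists>j. {i - 1, i} = {j, j + 1} \<and> j + 1 < k" if "i \<in> {1..<k}" for i
      using that by (intro exI[of _ "i - 1"]) auto
    ultimately show ?thesis unfolding path_graph_def by auto
  qed
  show "inj_on (\<lambda>i. {i - 1, i}) {1..<k}" by (auto simp: inj_on_def doubleton_eq_iff)
  show "interval_mset 2 (image_mset id (mset_set (verts (path_graph k))))"
    using assms by (intro interval_mset_2_image[where b = "k - 1"]) (auto simp: path_graph_def)
  fix x assume "x \<in> verts (path_graph k)"
  then have x: "x < k" by (simp add: path_graph_def)
  have "{i \<in> {1..<k}. x \<in> {i - 1, i}} = (if x = 0 then {} else {x}) \<union> (if Suc x < k then {Suc x} else {})"
    using x by auto
  then show "interval_mset 2 (add_mset (id x) (image_mset (\<lambda>i. i - 1) (mset_set {i \<in> {1..<k}. x \<in> {i - 1, i}})))"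
    using interval_mset_pair[of "x - 1" x] interval_mset_pair[of 0 0] interval_mset_triple[of "x - 1" x x]
    by (auto simp: interval_mset_def add_mset_commute)
qed simp

text \<open>
  The edges to the apex and to the center get the same color at each leaf. The apex and the center thus
  see the same colors, as the edge between them belongs to both.
\<close>
lemma cone_colorable_star: "cone_colorable 2 (star_graph k)"
proof (rule cone_colorable_indexed[where I = "{1..k}" and E = "\<lambda>i. {0, i}"
      and f = "\<lambda>i. i div 2" and h = "\<lambda>i. i div 2"])
  show "edges (star_graph k) = (\<lambda>i. {0, i}) ` {1..k}" by (auto simp: star_graph_def)
  show "inj_on (\<lambda>i. {0, i}) {1..k}" by (auto simp: inj_on_def doubleton_eq_iff)
  show apex: "interval_mset 2 (image_mset (\<lambda>i. i div 2) (mset_set (verts (star_graph k))))"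
  proof (rule interval_mset_2_image)
    show "(\<lambda>i. i div 2) ` verts (star_graph k) = {0..k div 2}"
    proof -
      have "j \<in> (\<lambda>i. i div 2) ` {0..k}" if "j \<le> k div 2" for j
        using that by (intro image_eqI[of _ _ "2 * j"]) auto
      then show ?thesis by (auto simp: star_graph_def div_le_mono)
    qed
    show "\<exists>x y. {z \<in> verts (star_graph k). z div 2 = j} \<subseteq> {x, y}" for j
      by (intro exI[of _ "2 * j"] exI[of _ "2 * j + 1"]) auto
  qed (simp add: star_graph_def)
  fix x assume x: "x \<in> verts (star_graph k)"
  show "interval_mset 2
      (add_mset (x div 2) (image_mset (\<lambda>i. i div 2) (mset_set {i \<in> {1..k}. x \<in> {0, i}})))"
  proof (cases "x = 0")
    case True
    have "verts (star_graph k) = insert 0 {1..k}" by (auto simp: star_graph_def)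
    moreover have "{i \<in> {1..k}. x \<in> {0, i}} = {1..k}" using True by auto
    ultimately show ?thesis using apex True by simp
  next
    case False
    then have "{i \<in> {1..k}. x \<in> {0, i}} = {x}" using x by (auto simp: star_graph_def)
    then show ?thesis by (simp add: interval_mset_pair)
  qed
qed simp

text \<open>
  On the way up, the edge that leaves \<open>i\<close> has color \<open>i + 1\<close>, and the vertex \<open>i\<close> sees \<open>i, i, i + 1\<close>.
  On the way down, with apex color \<open>j\<close>, the two edges have the colors \<open>j\<close> and \<open>j - 1\<close>. Shifting the
  second half by one in this way makes the two halves fit at the top: with the
  mirror image of the first half, the single top vertex of an odd cycle would see one color three times.
  For an even cycle the top is an edge between two vertices of the same apex color \<open>i\<close>, and \<open>i - 1\<close> is the
  color that suits both. The edge between the vertices \<open>k - 1\<close> and \<open>0\<close>, both of apex color \<open>0\<close>, gets the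
  color \<open>1\<close>.
\<close>
lemma cone_colorable_cycle:
  assumes k: "3 \<le> k"
  shows "cone_colorable 2 (cycle_graph k)"
proof -
  define h where "h i = (if i + 1 = k then 1 else if 2 * i + 2 < k then i + 1
    else if 2 * i + 2 = k then i - 1 else k - 2 - i)" for i
  show ?thesis
  proof (rule cone_colorable_indexed[where I = "{0..<k}" and E = "\<lambda>i. {i, (i + 1) mod k}"
        and f = "\<lambda>i. min i (k - 1 - i)" and h = h])
    show "edges (cycle_graph k) = (\<lambda>i. {i, (i + 1) mod k}) ` {0..<k}" by (auto simp: cycle_graph_def)
    show "inj_on (\<lambda>i. {i, (i + 1) mod k}) {0..<k}"
      using k by (auto simp: inj_on_def doubleton_eq_iff mod_Suc split: if_splits)
    show "interval_mset 2 (image_mset (\<lambda>i. min i (k - 1 - i)) (mset_set (verts (cycle_graph k))))"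
    proof (rule interval_mset_2_image)
      have "j \<in> (\<lambda>i. min i (k - 1 - i)) ` {0..<k}" if "j \<le> (k - 1) div 2" for j
        using that k by (intro image_eqI[of _ _ j]) auto
      then show "(\<lambda>i. min i (k - 1 - i)) ` verts (cycle_graph k) = {0..(k - 1) div 2}"
        by (auto simp: cycle_graph_def)
      show "\<exists>x y. {z \<in> verts (cycle_graph k). min z (k - 1 - z) = j} \<subseteq> {x, y}" for j
        by (intro exI[of _ j] exI[of _ "k - 1 - j"]) (auto simp: cycle_graph_def)
    qed (simp add: cycle_graph_def)
    fix x assume "x \<in> verts (cycle_graph k)"
    then have x: "x < k" by (simp add: cycle_graph_def)
    define y where "y = (if x = 0 then k - 1 else x - 1)"
    have "{i \<in> {0..<k}. x \<in> {i, (i + 1) mod k}} = {x, y}"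
      using x k by (auto simp: y_def mod_Suc split: if_splits)
    moreover have "x \<noteq> y" using k by (auto simp: y_def)
    moreover consider "x = 0" | "0 < x" "2 * x + 2 < k" | "0 < x" "2 * x + 2 = k" | "0 < x" "2 * x + 1 = k"
      | "2 * x = k" | "2 * x > k" "x + 1 < k" | "0 < x" "x + 1 = k" using x by linarith
    then have "interval_mset 2 {#min x (k - 1 - x), h x, h y#}"
    proof cases
      case 1
      then have "h x = 1" "h y = 1" using k by (auto simp: h_def y_def)
      then show ?thesis using 1 by (simp add: interval_mset_triple)
    next
      case 2
      then have "h x = x + 1" "h y = x" "min x (k - 1 - x) = x" by (auto simp: h_def y_def)
      then show ?thesis using interval_mset_triple[of x x "x + 1"] by (simp add: add_mset_commute)
    next
      case 3
      then have "h x = x - 1" "h y = x" "min x (k - 1 - x) = x" using k by (auto simp: h_def y_def)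
      then show ?thesis using 3 interval_mset_triple[of "x - 1" x x] by (simp add: add_mset_commute)
    next
      case 4
      then have "h x = x - 1" "h y = x" "min x (k - 1 - x) = x" using k by (auto simp: h_def y_def)
      then show ?thesis using 4 interval_mset_triple[of "x - 1" x x] by (simp add: add_mset_commute)
    next
      case 5
      then have "h x = x - 2" "h y = x - 2" "min x (k - 1 - x) = x - 1" "2 \<le> x"
        using k by (auto simp: h_def y_def)
      then show ?thesis using interval_mset_triple[of "x - 2" "x - 2" "x - 1"]
        by (simp add: add_mset_commute)
    next
      case 6
      then have "h x = k - 2 - x" "h y = k - 1 - x" "min x (k - 1 - x) = k - 1 - x" "x + 2 \<le> k"
        using k by (auto simp: h_def y_def)
      then show ?thesis using interval_mset_triple[of "k - 2 - x" "k - 1 - x" "k - 1 - x"]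
        by (simp add: add_mset_commute)
    next
      case 7
      then have "h x = 1" "h y = 0" "min x (k - 1 - x) = 0" using k by (auto simp: h_def y_def)
      then show ?thesis using interval_mset_triple[of 0 0 1] by (simp add: add_mset_commute)
    qed
    ultimately show "interval_mset 2 (add_mset (min x (k - 1 - x))
        (image_mset h (mset_set {i \<in> {0..<k}. x \<in> {i, (i + 1) mod k}})))"
      by simp
  qed simp
qed

section \<open>Spiders with at most four legs\<close>

text \<open>
  A normal form for spiders: the vertex \<open>(i, j)\<close> lies at distance \<open>j\<close> from the center \<open>(0, 0)\<close> on leg
  \<open>i < 4\<close>, which has \<open>l i\<close> vertices. Missing legs have length \<open>0\<close>.
  Each vertex except the center indexes the edge towards the center.
\<close>
definition leg_positions :: "(nat \<Rightarrow> nat) \<Rightarrow> (nat \<times> nat) set" where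
  "leg_positions l = (SIGMA i:{..<4}. {1..l i})"

definition leg_edge :: "nat \<times> nat \<Rightarrow> (nat \<times> nat) set" where
  "leg_edge = (\<lambda>(i, j). {if j = 1 then (0, 0) else (i, j - 1), (i, j)})"

definition spider_graph :: "(nat \<Rightarrow> nat) \<Rightarrow> (nat \<times> nat) sgraph" where
  "spider_graph l = \<lparr>verts = insert (0, 0) (leg_positions l), edges = leg_edge ` leg_positions l\<rparr>"

text \<open>The colors at the center of a spider with up to four legs.\<close>
lemma interval_mset_center:
  "interval_mset 2 {#0#}" "interval_mset 2 {#0, 0#}" "interval_mset 2 {#0, 0, 1#}"
  "interval_mset 2 {#0, 0, 1, 2#}" "interval_mset 2 {#0, 0, 1, 2, 1#}"
proof -
  have "{0} = {0..0::nat}" "{0, 1} = {0..1::nat}" "{0, 1, 2} = {0..2::nat}" by auto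
  then have "\<exists>a b. set_mset {#0#} = {a..b::nat}" "\<exists>a b. set_mset {#0, 0#} = {a..b::nat}"
    "\<exists>a b. set_mset {#0, 0, 1#} = {a..b::nat}" "\<exists>a b. set_mset {#0, 0, 1, 2#} = {a..b::nat}"
    "\<exists>a b. set_mset {#0, 0, 1, 2, 1#} = {a..b::nat}"
    by (metis set_mset_add_mset_insert set_mset_empty insert_absorb2 insert_commute)+
  then show "interval_mset 2 {#0#}" "interval_mset 2 {#0, 0#}" "interval_mset 2 {#0, 0, 1#}"
    "interval_mset 2 {#0, 0, 1, 2#}" "interval_mset 2 {#0, 0, 1, 2, 1#}"
    unfolding interval_mset_def by (simp_all only: simp_thms) auto
qed

text \<open>
  Legs \<open>0\<close> and \<open>2\<close> use the odd apex colors and legs \<open>1\<close> and \<open>3\<close> the even ones; behind position \<open>l 1\<close>,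
  leg \<open>0\<close> continues alone with all further colors. An edge of a leg has a color one less than the apex
  color of its outer end, which makes every inner vertex of a leg see three consecutive colors, or \<open>n - 1, n, n\<close>
  on the slow part. The center would then see \<open>0\<close> three times (on its apex edge and on legs \<open>0\<close>
  and \<open>2\<close>). The first edge of leg \<open>2\<close> therefore gets the color \<open>2\<close>, which its outer end, with apex color \<open>1\<close>
  and next color \<open>2\<close>, allows; with four legs, the center then sees
  \<open>0, 0, 1, 2, 1\<close>.
\<close>
lemma cone_colorable_spider:
  assumes l: "l 1 \<le> l 0" "l 2 \<le> l 1" "l 3 \<le> l 2"
  shows "cone_colorable 2 (spider_graph l)"
proof -
  define f where "f = (\<lambda>(i::nat, j). if i = 0 then if j \<le> l 1 then 2 * j - 1 else l 1 + j
    else if i = 2 then 2 * j - 1 else 2 * j)"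
  define h where "h = (\<lambda>(i, j). if (i, j) = (2, 1) then 2 else f (i, j) - 1)"
  have f_center: "f (0, 0) = 0" by (simp add: f_def)
  have fin: "finite (leg_positions l)" by (simp add: leg_positions_def)
  have four: "i = 0 \<or> i = 1 \<or> i = 2 \<or> i = 3" if "i < 4" for i :: nat
    using that by linarith
  show ?thesis
  proof (rule cone_colorable_indexed[where I = "leg_positions l" and E = leg_edge and f = f and h = h])
    show "edges (spider_graph l) = leg_edge ` leg_positions l" by (simp add: spider_graph_def)
    show "inj_on leg_edge (leg_positions l)"
      by (auto simp: inj_on_def leg_positions_def leg_edge_def doubleton_eq_iff split: if_splits)
    show "finite (leg_positions l)" by (fact fin)
    show "interval_mset 2 (image_mset f (mset_set (verts (spider_graph l))))"
    proof (rule interval_mset_2_image)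
      have "n \<in> f ` insert (0, 0) (leg_positions l)" if n: "n \<le> l 0 + l 1" for n
      proof -
        consider "n = 0" | j where "n = 2 * j - 1" "1 \<le> j" "j \<le> l 1" | j where "n = 2 * j" "1 \<le> j" "j \<le> l 1"
          | "2 * l 1 < n"
        proof (cases "even n")
          case True
          then obtain j where "n = 2 * j" by blast
          then show ?thesis using that by force
        next
          case False
          then obtain j where "n = 2 * j + 1" by (auto elim: oddE)
          then show ?thesis using that(2)[of "j + 1"] that(4) by force
        qed
        then show ?thesis
        proof cases
          case 1
          then show ?thesis by (intro image_eqI[of _ _ "(0, 0)"]) (auto simp: f_def)
        next
          case (2 j)
          then show ?thesis using l
            by (intro image_eqI[of _ _ "(0, j)"]) (auto simp: f_def leg_positions_def)
        next
          case (3 j)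
          then show ?thesis using l
            by (intro image_eqI[of _ _ "(1, j)"]) (auto simp: f_def leg_positions_def)
        next
          case 4
          then show ?thesis using l n
            by (intro image_eqI[of _ _ "(0, n - l 1)"]) (auto simp: f_def leg_positions_def)
        qed
      qed
      then have "{0..l 0 + l 1} \<subseteq> f ` verts (spider_graph l)"
        by (simp add: spider_graph_def subset_eq del: image_insert)
      moreover have "f p \<le> l 0 + l 1" if "p \<in> leg_positions l" for p
        using that l four by (fastforce simp: leg_positions_def f_def)
      then have "f ` verts (spider_graph l) \<subseteq> {0..l 0 + l 1}"
        using f_center by (auto simp: spider_graph_def)
      ultimately show "f ` verts (spider_graph l) = {0..l 0 + l 1}" by blast
      fix n
      let ?x = "if n = 0 then (0, 0) else if 2 * l 1 < n then (0, n - l 1)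
        else if even n then (1, n div 2) else (0, (n + 1) div 2)"
      let ?y = "if even n then (3, n div 2) else (2, (n + 1) div 2)"
      have "{z \<in> verts (spider_graph l). f z = n} \<subseteq> {?x, ?y}"
        using l by (auto simp: spider_graph_def leg_positions_def f_def dest!: four split: if_splits)
      then show "\<exists>x y. {z \<in> verts (spider_graph l). f z = n} \<subseteq> {x, y}" by blast
    qed (simp add: spider_graph_def fin)
    fix x assume x: "x \<in> verts (spider_graph l)"
    show "interval_mset 2 (add_mset (f x) (image_mset h (mset_set {i \<in> leg_positions l. x \<in> leg_edge i})))"
    proof (cases "x = (0, 0)")
      case True
      have "{i \<in> leg_positions l. x \<in> leg_edge i} = (\<lambda>i. (i, 1)) ` {i \<in> {0, 1, 2, 3}. 0 < l i}"
        using True by (auto simp: leg_positions_def leg_edge_def split: if_splits)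
      then have center: "image_mset h (mset_set {i \<in> leg_positions l. x \<in> leg_edge i})
          = image_mset (\<lambda>i. h (i, 1)) (mset_set {i \<in> {0, 1, 2, 3}. 0 < l i})"
        by (simp add: inj_on_def multiset.map_comp comp_def flip: image_mset_mset_set)
      have legs: "mset_set {i \<in> {0, 1, 2, 3}. 0 < l i} = filter_mset (\<lambda>i. 0 < l i) {#0, 1, 2, 3#}"
        using filter_mset_mset_set[of "{0, 1, 2, 3}" "\<lambda>i. 0 < l i"] by (simp del: filter_mset_mset_set)
      have h: "h (0, 1) = 0" "h (1, 1) = 1" "h (2, 1) = 2" "h (3, 1) = 1"
        by (auto simp: h_def f_def)
      have "interval_mset 2 (add_mset 0 (image_mset (\<lambda>i. h (i, 1)) (mset_set {i \<in> {0, 1, 2, 3}. 0 < l i})))"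
      proof -
        consider "l 0 = 0" | "0 < l 0" "l 1 = 0" | "0 < l 1" "l 2 = 0" | "0 < l 2" "l 3 = 0" | "0 < l 3"
          by blast
        then show ?thesis
        proof cases
          case 1
          then have "l 0 = 0" "l 1 = 0" "l 2 = 0" "l 3 = 0" using l by linarith+
          then show ?thesis using interval_mset_center(1) unfolding legs by (simp add: h[simplified])
        next
          case 2
          then have "0 < l 0" "l 1 = 0" "l 2 = 0" "l 3 = 0" using l by linarith+
          then show ?thesis using interval_mset_center(2) unfolding legs by (simp add: h[simplified])
        next
          case 3
          then have "0 < l 0" "0 < l 1" "l 2 = 0" "l 3 = 0" using l by linarith+
          then show ?thesis using interval_mset_center(3) unfolding legs by (simp add: h[simplified])
        next
          case 4
          then have "0 < l 0" "0 < l 1" "0 < l 2" "l 3 = 0" using l by linarith+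
          then show ?thesis using interval_mset_center(4) unfolding legs by (simp add: h[simplified])
        next
          case 5
          then have "0 < l 0" "0 < l 1" "0 < l 2" "0 < l 3" using l by linarith+
          then show ?thesis using interval_mset_center(5) unfolding legs by (simp add: h[simplified])
        qed
      qed
      then show ?thesis unfolding center using True f_center by simp
    next
      case False
      then obtain i j where ij: "x = (i, j)" "i < 4" "1 \<le> j" "j \<le> l i"
        using x by (auto simp: spider_graph_def leg_positions_def)
      then have "{i \<in> leg_positions l. x \<in> leg_edge i} = insert (i, j) (if j < l i then {(i, Suc j)} else {})"
        by (auto simp: leg_positions_def leg_edge_def split: if_splits)
      moreover have "interval_mset 2 {#f (i, j), h (i, j)#}"
      proof (cases "(i, j) = (2, 1)")
        case True
        then show ?thesis using interval_mset_pair[of 1 2] by (simp add: f_def h_def)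
      next
        case False
        then have "h (i, j) = f (i, j) - 1" by (auto simp: h_def)
        then show ?thesis
          using interval_mset_pair[of "f (i, j) - 1" "f (i, j)"] by (simp add: add_mset_commute)
      qed
      moreover have "interval_mset 2 {#f (i, j), h (i, j), h (i, Suc j)#}"
      proof -
        consider "i = 0" "l 1 < j" | "(i, j) = (2, 1)" | "\<not> (i = 0 \<and> l 1 < j)" "(i, j) \<noteq> (2, 1)" by blast
        then show ?thesis
        proof cases
          case 1
          then have "f (i, j) = l 1 + j" "h (i, j) = l 1 + j - 1" "h (i, Suc j) = l 1 + j"
            by (auto simp: f_def h_def)
          then show ?thesis using 1 interval_mset_triple[of "l 1 + j - 1" "l 1 + j" "l 1 + j"]
            by (simp add: add_mset_commute)
        next
          case 2
          then show ?thesis using interval_mset_triple[of 1 2 2] by (simp add: f_def h_def)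
        next
          case 3
          then have "h (i, j) = f (i, j) - 1" "h (i, Suc j) = f (i, j) + 1" "1 \<le> f (i, j)"
            using four[OF ij(2)] ij(3) by (auto simp: f_def h_def)
          then show ?thesis using interval_mset_triple[of "f (i, j) - 1" "f (i, j)" "f (i, j) + 1"]
            by (simp add: add_mset_commute)
        qed
      qed
      ultimately show ?thesis using ij by auto
    qed
  qed
qed

section \<open>Finding the legs of a spider\<close>

lemma acyclic_graph_no_chord:
  assumes "acyclic_graph G" "inj_on w {i..n}" "i + 2 \<le> n" "w ` {i..n} \<subseteq> verts G"
    and "\<And>j. i \<le> j \<Longrightarrow> j < n \<Longrightarrow> {w j, w (Suc j)} \<in> edges G"
  shows "{w n, w i} \<notin> edges G"
proof
  assume closing: "{w n, w i} \<in> edges G"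
  let ?k = "Suc (n - i)"
  have "subgraph_embedding (\<lambda>t. w (i + t)) (cycle_graph ?k) G"
    unfolding subgraph_embedding_def
  proof (intro conjI subsetI)
    show "inj_on (\<lambda>t. w (i + t)) (verts (cycle_graph ?k))"
      using assms(3) by (auto simp: inj_on_def cycle_graph_def dest!: inj_onD[OF assms(2)])
    show "v \<in> verts G" if "v \<in> (\<lambda>t. w (i + t)) ` verts (cycle_graph ?k)" for v
      using that assms(3,4) by (auto simp: cycle_graph_def)
    fix e assume "e \<in> (`) (\<lambda>t. w (i + t)) ` edges (cycle_graph ?k)"
    then obtain t where t: "t < ?k" "e = {w (i + t), w (i + (t + 1) mod ?k)}"
      by (auto simp: cycle_graph_def)
    show "e \<in> edges G"
    proof (cases "t = n - i")
      case True
      then show ?thesis using t closing assms(3) by simp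
    next
      case False
      then show ?thesis using t assms(5)[of "i + t"] by simp
    qed
  qed
  moreover have "3 \<le> ?k" using assms(3) by linarith
  ultimately show False using assms(1) unfolding acyclic_graph_def by blast
qed

definition is_path :: "'a sgraph \<Rightarrow> (nat \<Rightarrow> 'a) \<Rightarrow> nat \<Rightarrow> bool" where
  "is_path G w n \<longleftrightarrow> 1 \<le> n \<and> inj_on w {0..n} \<and> w ` {0..n} \<subseteq> verts G \<and>
     (\<forall>j<n. {w j, w (Suc j)} \<in> edges G)"

lemma simple_graph_edgeD:
  assumes "simple_graph G" "{x, y} \<in> edges G"
  shows "x \<in> verts G" "y \<in> verts G" "x \<noteq> y"
proof -
  have "{x, y} \<subseteq> verts G" "card {x, y} = 2" using assms unfolding simple_graph_def by blast+
  then show "x \<in> verts G" "y \<in> verts G" "x \<noteq> y" by (auto simp: card_insert_if split: if_splits)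
qed

lemma degree_ge_3:
  assumes "simple_graph G" "{x, a} \<in> edges G" "{x, b} \<in> edges G" "{x, y} \<in> edges G"
    and "a \<noteq> b" "y \<noteq> a" "y \<noteq> b"
  shows "3 \<le> degree G x"
proof -
  have "card {{x, a}, {x, b}, {x, y}} \<le> degree G x"
    unfolding degree_def using assms
    by (intro card_mono) (auto simp: incident_edges_def finite_edges)
  then show ?thesis using assms by (simp add: doubleton_eq_iff)
qed

text \<open>
  The leg is a longest path that starts at \<open>c\<close> with the edge to \<open>u\<close>. An inner vertex cannot have a
  neighbor outside the path, since its two neighbors on the path already account for its degree. A neighbor of
  the last vertex lies on the path by maximality, and if it were not the previous vertex, the edge
  to it would close a cycle.
\<close>
lemma leg_exists:
  assumes G: "simple_graph G" "acyclic_graph G" and cu: "{c, u} \<in> edges G"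
    and deg: "\<And>v. v \<in> verts G \<Longrightarrow> v \<noteq> c \<Longrightarrow> degree G v \<le> 2"
  obtains w n where "is_path G w n" "w 0 = c" "w 1 = u"
    "\<And>j y. 1 \<le> j \<Longrightarrow> j \<le> n \<Longrightarrow> {w j, y} \<in> edges G \<Longrightarrow> y = w (j - 1) \<or> j < n \<and> y = w (Suc j)"
proof -
  define P where "P n \<longleftrightarrow> (\<exists>w. is_path G w n \<and> w 0 = c \<and> w 1 = u)" for n
  have bound: "n \<le> card (verts G)" if P: "P n" for n
  proof -
    obtain w where "inj_on w {0..n}" "w ` {0..n} \<subseteq> verts G"
      using P unfolding P_def is_path_def by blast
    then have "card {0..n} \<le> card (verts G)"
      using G by (intro card_inj_on_le) (auto simp: simple_graph_def)
    then show ?thesis by simp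
  qed
  have "P 1"
    unfolding P_def is_path_def using simple_graph_edgeD[OF G(1) cu] cu
    by (intro exI[of _ "\<lambda>j. if j = 0 then c else u"]) (auto simp: inj_on_def)
  then obtain n where "P n" and max: "\<And>m. P m \<Longrightarrow> m \<le> n"
    using Greatest_le_nat[of P _ "card (verts G)"] GreatestI_nat[of P 1 "card (verts G)"] bound by metis
  then obtain w where w: "is_path G w n" "w 0 = c" "w 1 = u" by (auto simp: P_def)
  then have inj: "inj_on w {0..n}" and verts: "w ` {0..n} \<subseteq> verts G"
    and adj: "\<And>j. j < n \<Longrightarrow> {w j, w (Suc j)} \<in> edges G" and n: "1 \<le> n"
    unfolding is_path_def by blast+
  have "y = w (j - 1) \<or> j < n \<and> y = w (Suc j)" if j: "1 \<le> j" "j \<le> n" and e: "{w j, y} \<in> edges G" for j y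
  proof (cases "j < n")
    case True
    have "w (j - 1) \<noteq> w (Suc j)" "w j \<noteq> w 0"
      using True j by (auto dest!: inj_onD[OF inj])
    moreover have "w j \<in> verts G" using j verts by auto
    moreover have "{w j, w (j - 1)} \<in> edges G"
      using adj[of "j - 1"] j by (simp add: insert_commute)
    ultimately show ?thesis
      using degree_ge_3[OF G(1) _ adj[OF True] e] deg[of "w j"] w(2) True by fastforce
  next
    case False
    then have [simp]: "j = n" using j by simp
    have "y \<in> w ` {0..n}"
    proof (rule ccontr)
      assume y: "y \<notin> w ` {0..n}"
      have "P (Suc n)"
        unfolding P_def is_path_def
      proof (intro exI conjI allI impI)
        let ?w = "w(Suc n := y)"
        show "inj_on ?w {0..Suc n}"
          using inj y by (auto simp: inj_on_def atLeast0_atMost_Suc)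
        show "?w ` {0..Suc n} \<subseteq> verts G"
          using verts simple_graph_edgeD[OF G(1) e] by (auto simp: atLeast0_atMost_Suc)
        show "{?w i, ?w (Suc i)} \<in> edges G" if "i < Suc n" for i
          using that adj[of i] e by (cases "i = n") auto
      qed (use w n in auto)
      then show False using max by fastforce
    qed
    then obtain i where i: "i \<le> n" "y = w i" by auto
    have "i \<noteq> n" using i simple_graph_edgeD[OF G(1) e] by auto
    moreover have "\<not> i + 2 \<le> n"
    proof
      assume "i + 2 \<le> n"
      moreover have "inj_on w {i..n}" by (rule inj_on_subset[OF inj]) auto
      moreover have "w ` {i..n} \<subseteq> verts G" using verts by auto
      ultimately show False
        using acyclic_graph_no_chord[OF G(2), of w i n] adj e i by auto
    qed
    ultimately have "i = n - 1" using i by linarith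
    then show ?thesis using i by simp
  qed
  then show thesis using that w by blast
qed

text \<open>
  One leg starts at each neighbor of the center, and a noncentral vertex of a leg has no
  neighbors off the leg. Two different legs therefore share only the center: a common vertex
  could be pushed towards the center along one of them, until the first vertex of this leg would have to be
  the first vertex of the other leg too. Together the legs form a set that is closed under
  adjacency, so by connectedness they cover the graph.
\<close>
lemma spider_isomorphic:
  assumes tree: "tree H" and c: "c \<in> verts H" "degree H c \<le> 4"
    and deg: "\<And>v. v \<in> verts H \<Longrightarrow> v \<noteq> c \<Longrightarrow> degree H v \<le> 2"
  obtains l where "l 1 \<le> l 0" "l 2 \<le> l 1" "l 3 \<le> l 2" "spider_graph l \<cong>\<^sub>g H"
proof -
  have H: "simple_graph H" "acyclic_graph H" "connected_graph H"
    using tree by (auto simp: tree_def)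
  define N where "N = {u. {c, u} \<in> edges H}"
  define L where "L u w n \<longleftrightarrow> is_path H w n \<and> w 0 = c \<and> w 1 = u \<and> (\<forall>j y. 1 \<le> j \<longrightarrow> j \<le> n \<longrightarrow>
    {w j, y} \<in> edges H \<longrightarrow> y = w (j - 1) \<or> j < n \<and> y = w (Suc j))" for u w n
  have "\<exists>w n. L u w n" if "u \<in> N" for u
  proof -
    have "{c, u} \<in> edges H" using that by (simp add: N_def)
    from leg_exists[OF H(1,2) this deg] obtain w n where "is_path H w n" "w 0 = c" "w 1 = u"
      and "\<And>j y. 1 \<le> j \<Longrightarrow> j \<le> n \<Longrightarrow> {w j, y} \<in> edges H \<Longrightarrow> y = w (j - 1) \<or> j < n \<and> y = w (Suc j)"
      by metis
    then show ?thesis unfolding L_def by (intro exI conjI allI impI)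
  qed
  then obtain W len where L: "\<And>u. u \<in> N \<Longrightarrow> L u (W u) (len u)" by metis
  have W: "\<And>u. u \<in> N \<Longrightarrow> is_path H (W u) (len u)"
    and W0: "\<And>u. u \<in> N \<Longrightarrow> W u 0 = c" and W1: "\<And>u. u \<in> N \<Longrightarrow> W u 1 = u"
    and Wnb: "\<And>u j y. u \<in> N \<Longrightarrow> 1 \<le> j \<Longrightarrow> j \<le> len u \<Longrightarrow> {W u j, y} \<in> edges H \<Longrightarrow>
      y = W u (j - 1) \<or> j < len u \<and> y = W u (Suc j)"
    using L unfolding L_def by blast+
  have W_inj: "W u i = W u j \<Longrightarrow> i = j" if "u \<in> N" "i \<le> len u" "j \<le> len u" for u i j
    using W[OF that(1)] that unfolding is_path_def inj_on_def by simp
  have W_vert: "W u j \<in> verts H" if "u \<in> N" "j \<le> len u" for u j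
    using W[OF that(1)] that unfolding is_path_def by fastforce
  have W_adj: "{W u j, W u (Suc j)} \<in> edges H" if "u \<in> N" "j < len u" for u j
    using W[OF that(1)] that unfolding is_path_def by blast
  have not_c: "W u j \<noteq> c" if "u \<in> N" "1 \<le> j" "j \<le> len u" for u j
    using W_inj[of u j 0] W0 that by auto
  have len: "1 \<le> len u" if "u \<in> N" for u
    using W[OF that(1)] unfolding is_path_def by blast
  have disjoint: "u = u' \<and> i = j" if "u \<in> N" "u' \<in> N" "1 \<le> i" "i \<le> len u" "1 \<le> j" "j \<le> len u'" "W u i = W u' j" for u u' i j
    using that
  proof (induction i arbitrary: j)
    case (Suc i)
    show ?case
    proof (cases "i = 0")
      case True
      have "{W u' j, c} \<in> edges H"
        using W_adj[of u 0] Suc.prems True W0 by (simp add: insert_commute)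
      then have "c = W u' (j - 1) \<or> j < len u' \<and> c = W u' (Suc j)"
        using Wnb Suc.prems by blast
      moreover have "1 \<le> j - 1 \<and> j - 1 \<le> len u'" if "j \<noteq> 1" using that Suc.prems by linarith
      ultimately have "j = 1"
        using not_c[of u' "j - 1"] not_c[of u' "Suc j"] Suc.prems by auto
      then show ?thesis using Suc.prems True W1 by auto
    next
      case False
      have "{W u' j, W u i} \<in> edges H"
        using W_adj[of u i] Suc.prems by (simp add: insert_commute)
      then have "W u i = W u' (j - 1) \<or> j < len u' \<and> W u i = W u' (Suc j)"
        using Wnb Suc.prems by blast
      then obtain m where m: "m \<le> len u'" "W u i = W u' m"
        using Suc.prems by (metis Suc_leI diff_le_self le_trans)
      have "W u i \<noteq> c" using not_c[of u i] False Suc.prems by simp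
      then have "m \<noteq> 0" using m W0[OF Suc.prems(2)] by metis
      then have "u = u' \<and> i = m" using Suc.IH[of m] Suc.prems False m by auto
      then show ?thesis using Suc.prems W_inj[of u "Suc i" j] by auto
    qed
  qed simp
  have cover: "\<exists>u\<in>N. \<exists>j\<in>{1..len u}. v = W u j" if v: "v \<in> verts H" "v \<noteq> c" for v
  proof -
    have "(c, v) \<in> {(x, y). {x, y} \<in> edges H}\<^sup>*"
      using H(3) c(1) v(1) by (simp add: connected_graph_def)
    then have "v = c \<or> (\<exists>u\<in>N. \<exists>j\<in>{1..len u}. v = W u j)"
    proof (induction rule: rtrancl_induct)
      case (step y z)
      from step.IH show ?case
      proof
        assume "y = c"
        then have "z \<in> N" using step.hyps by (simp add: N_def)
        then show ?thesis using W1[of z] len[of z] by (intro disjI2 bexI[of _ z] bexI[of _ 1]) auto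
      next
        assume "\<exists>u\<in>N. \<exists>j\<in>{1..len u}. y = W u j"
        then obtain u j where u: "u \<in> N" "1 \<le> j" "j \<le> len u" "y = W u j" by auto
        then consider "z = W u (j - 1)" | "j < len u" "z = W u (Suc j)"
          using Wnb step.hyps by blast
        then show ?thesis
          using u W0 by cases (cases "j = 1"; force)+
      qed
    qed simp
    then show ?thesis using v by simp
  qed
  have N_verts: "N \<subseteq> verts H" using simple_graph_edgeD[OF H(1)] by (auto simp: N_def)
  then have finN: "finite N" using H(1) by (auto simp: simple_graph_def intro: finite_subset)
  have cardN: "card N \<le> 4"
  proof -
    have "card N = card ((\<lambda>u. {c, u}) ` N)"
      by (intro card_image[symmetric]) (auto simp: inj_on_def doubleton_eq_iff)
    also have "\<dots> \<le> degree H c"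
      unfolding degree_def using H(1)
      by (intro card_mono) (auto simp: N_def incident_edges_def finite_edges)
    finally show ?thesis using c(2) by simp
  qed
  obtain xs where xs: "set xs = N" "distinct xs" using finite_distinct_list[OF finN] by blast
  \<comment> \<open>The neighbors of the center, listed by decreasing length of their legs.\<close>
  define us where "us = rev (sort_key len xs)"
  have us: "set us = N" "distinct us" "length us \<le> 4"
    using xs cardN distinct_card[of xs] by (auto simp: us_def)
  have us_sorted: "len (us ! j) \<le> len (us ! i)" if "i \<le> j" "j < length us" for i j
  proof -
    have "sorted (rev (map len us))" by (simp add: us_def rev_map)
    then show ?thesis using that by (auto dest: sorted_rev_nth_mono)
  qed
  define l where "l i = (if i < length us then len (us ! i) else 0)" for i
  define \<phi> where "\<phi> = (\<lambda>(i, j). if j = 0 then c else W (us ! i) j)"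
  have usN: "us ! i \<in> N" if "i < length us" for i using us that by auto
  have pos: "(i, j) \<in> leg_positions l \<longleftrightarrow> i < length us \<and> 1 \<le> j \<and> j \<le> len (us ! i)" for i j
    using us(3) by (auto simp: leg_positions_def l_def)
  have image: "\<phi> ` leg_positions l = {W u j | u j. u \<in> N \<and> 1 \<le> j \<and> j \<le> len u}"
  proof (intro equalityI subsetI)
    fix v assume "v \<in> {W u j | u j. u \<in> N \<and> 1 \<le> j \<and> j \<le> len u}"
    then obtain u j where u: "u \<in> N" "1 \<le> j" "j \<le> len u" "v = W u j" by auto
    then obtain i where "i < length us" "us ! i = u" using us(1) by (metis in_set_conv_nth)
    then show "v \<in> \<phi> ` leg_positions l"
      using u by (intro image_eqI[of _ _ "(i, j)"]) (auto simp: \<phi>_def pos)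
  next
    fix v assume "v \<in> \<phi> ` leg_positions l"
    then show "v \<in> {W u j | u j. u \<in> N \<and> 1 \<le> j \<and> j \<le> len u}"
      using usN by (fastforce simp: \<phi>_def pos)
  qed
  have "spider_graph l \<cong>\<^sub>g H"
    unfolding isomorphic_def
  proof (intro exI conjI)
    have "inj_on \<phi> (leg_positions l)"
    proof (rule inj_onI)
      fix p q assume pq: "p \<in> leg_positions l" "q \<in> leg_positions l" "\<phi> p = \<phi> q"
      obtain i j i' j' where [simp]: "p = (i, j)" "q = (i', j')" by fastforce
      have "us ! i = us ! i' \<and> j = j'"
        using pq usN by (intro disjoint) (auto simp: pos \<phi>_def)
      then show "p = q" using pq us(2) by (auto simp: pos nth_eq_iff_index_eq)
    qed
    moreover have "\<phi> (0, 0) \<notin> \<phi> ` leg_positions l"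
      unfolding image using not_c by (fastforce simp: \<phi>_def)
    ultimately have "inj_on \<phi> (verts (spider_graph l))"
      by (auto simp: spider_graph_def)
    moreover have "\<phi> ` verts (spider_graph l) = verts H"
    proof -
      have "verts H = insert c {W u j | u j. u \<in> N \<and> 1 \<le> j \<and> j \<le> len u}"
        using cover W_vert c(1) by fastforce
      then show ?thesis using image by (simp add: spider_graph_def) (simp add: \<phi>_def)
    qed
    ultimately show "bij_betw \<phi> (verts (spider_graph l)) (verts H)" by (simp add: bij_betw_def)
    have leg_edge_image: "\<phi> ` leg_edge (i, j) = {W (us ! i) (j - 1), W (us ! i) j}" if "(i, j) \<in> leg_positions l" for i j
      using that W0 usN by (auto simp: leg_edge_def \<phi>_def pos)
    show "edges H = (`) \<phi> ` edges (spider_graph l)"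
    proof (intro equalityI subsetI)
      fix e assume "e \<in> (`) \<phi> ` edges (spider_graph l)"
      then obtain i j where ij: "(i, j) \<in> leg_positions l" "e = \<phi> ` leg_edge (i, j)"
        by (auto simp: spider_graph_def)
      then have "e = {W (us ! i) (j - 1), W (us ! i) (Suc (j - 1))}" "us ! i \<in> N" "j - 1 < len (us ! i)"
        using usN by (auto simp: leg_edge_image pos)
      then show "e \<in> edges H" using W_adj by simp
    next
      fix e assume e: "e \<in> edges H"
      have edge_image: "{W u (j - 1), W u j} \<in> (`) \<phi> ` edges (spider_graph l)"
        if u: "u \<in> N" "1 \<le> j" "j \<le> len u" for u j
      proof -
        obtain i where "i < length us" "us ! i = u" using us(1) u by (metis in_set_conv_nth)
        then have "(i, j) \<in> leg_positions l" "\<phi> ` leg_edge (i, j) = {W u (j - 1), W u j}"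
          using u leg_edge_image[of i j] by (auto simp: pos)
        moreover from this(1) have "\<phi> ` leg_edge (i, j) \<in> (`) \<phi> ` edges (spider_graph l)"
          by (simp add: spider_graph_def)
        ultimately show ?thesis by simp
      qed
      have "card e = 2" using e H(1) unfolding simple_graph_def by blast
      then obtain a b where "e = {a, b}" unfolding card_2_iff by blast
      then have ab: "e = {a, b}" "a \<in> verts H" "b \<in> verts H"
        using simple_graph_edgeD[OF H(1), of a b] e by auto
      show "e \<in> (`) \<phi> ` edges (spider_graph l)"
      proof (cases "a = c")
        case True
        then have "b \<in> N" using e ab by (simp add: N_def)
        then show ?thesis using edge_image[of b 1] len[of b] W0 W1 True ab by simp
      next
        case False
        then obtain u j where u: "u \<in> N" "1 \<le> j" "j \<le> len u" "a = W u j"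
          using cover[OF ab(2)] by auto
        then consider "b = W u (j - 1)" | "j < len u" "b = W u (Suc j)"
          using Wnb e ab(1) by blast
        then show ?thesis
        proof cases
          case 1
          then show ?thesis using edge_image[OF u(1-3)] u ab by (simp add: insert_commute)
        next
          case 2
          then show ?thesis using edge_image[of u "Suc j"] u ab by simp
        qed
      qed
    qed
  qed
  moreover have "l j \<le> l i" if "i \<le> j" for i j
    using us_sorted[of i j] that by (auto simp: l_def)
  ultimately show thesis using that[of l] by simp
qed

section \<open>The impropriety of coronas of paths, cycles, stars and small spiders\<close>

theorem corollary22:
  fixes G :: "'a sgraph" and H :: "'b sgraph"
  assumes "simple_graph G" and "simple_graph H"
    and "(\<exists>k\<ge>1. H \<cong>\<^sub>g path_graph k) \<or>
         (\<exists>k\<ge>3. H \<cong>\<^sub>g cycle_graph k) \<or>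
         (\<exists>k\<ge>1. H \<cong>\<^sub>g star_graph k) \<or>
         (\<exists>k\<le>4. H \<in> SP k)"
  shows "mu_int (G \<odot> H) \<le> max 2 (mu_int G)"
proof -
  have H: "edges H \<subseteq> Pow (verts H)" using assms(2) by (auto simp: simple_graph_def)
  have "cone_colorable 2 H' \<Longrightarrow> H \<cong>\<^sub>g H' \<Longrightarrow> cone_colorable 2 H" for H' :: "nat sgraph"
    using cone_colorable_isomorphic[OF H] by blast
  moreover have "cone_colorable 2 H" if "H \<in> SP k" "k \<le> 4" for k
  proof -
    obtain c where c: "tree H" "c \<in> verts H" "degree H c \<le> 4"
        "\<And>v. v \<in> verts H \<Longrightarrow> v \<noteq> c \<Longrightarrow> degree H v \<le> 2"
      using \<open>H \<in> SP k\<close> \<open>k \<le> 4\<close> by (auto simp: SP_def)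
    obtain l where l: "l 1 \<le> l 0" "l 2 \<le> l 1" "l 3 \<le> l 2" "spider_graph l \<cong>\<^sub>g H"
      using spider_isomorphic[OF c] by blast
    have "leg_edge (i, j) \<subseteq> insert (0, 0) (leg_positions l)" if "(i, j) \<in> leg_positions l" for i j
      using that by (auto simp: leg_edge_def leg_positions_def)
    then have "edges (spider_graph l) \<subseteq> Pow (verts (spider_graph l))"
      by (fastforce simp: spider_graph_def)
    then have "H \<cong>\<^sub>g spider_graph l" using l(4) by (rule isomorphic_sym)
    then show ?thesis using cone_colorable_isomorphic[OF H] cone_colorable_spider[OF l(1-3)] by blast
  qed
  ultimately have "cone_colorable 2 H"
    using assms(3) cone_colorable_path cone_colorable_cycle cone_colorable_star by blast
  then show ?thesis using mu_int_corona_le[OF assms(1,2)] by simp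
qed

end
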